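(* Let $D$ be a division ring with center $F$, and let $n$ be a positive integer. Then the equality $$\mathrm{M}_n(D) = Z(\mathrm{M}_n(D)) + [\mathrm{M}_n(D), \mathrm{M}_n(D)]$$ holds in either of the following cases: (i) $D$ is an algebraic division ring of characteristic zero. (ii) $D$ is finite-dimensional over $F$, where $\operatorname{char}(F) = p > 0$, and $p$ divides neither $\sqrt{\dim_F D}$ nor $n$.
   Context: $\mathrm{M}_n(A)$ denotes the ring of $n\times n$ matrices over a unital associative algebra $A$. For a unital associative algebra $A$, $Z(A)$ is its center and $[A,A]$ is the additive subgroup of $A$ generated by all additive commutators $ab-ba$ with $a,b\in A$. A division ring $D$ is called algebraic if every element of $D$ satisfies a nonzero polynomial with coefficients in the center of $D$. When a division ring $D$ is finite-dimensional over its center $F$, $\dim_F D$ is a perfect square, so $\sqrt{\dim_F D}$ is a positive integer. *)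

theory Defs
  imports
    "HOL-Algebra.Finite_Extensions"
    "HOL-Algebra.Algebraic_Closure_Type"
    "HOL-Library.Discrete_Functions"
    "Jordan_Normal_Form.Matrix"
begin

definition ring_center :: "('a, 'b) ring_scheme \<Rightarrow> 'a set" where
  "ring_center R = {z \<in> carrier R. \<forall>x \<in> carrier R. z \<otimes>\<^bsub>R\<^esub> x = x \<otimes>\<^bsub>R\<^esub> z}"

definition additive_commutators :: "('a, 'b) ring_scheme \<Rightarrow> 'a set" where
  "additive_commutators R =
     {(a \<otimes>\<^bsub>R\<^esub> b) \<ominus>\<^bsub>R\<^esub> (b \<otimes>\<^bsub>R\<^esub> a) | a b. a \<in> carrier R \<and> b \<in> carrier R}"

text \<open>The additive subgroup \<open>[R, R]\<close>, not the two-sided ideal generated by the commutators.\<close>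

definition commutator_subgroup :: "('a, 'b) ring_scheme \<Rightarrow> 'a set" where
  "commutator_subgroup R = generate (add_monoid R) (additive_commutators R)"

text \<open>
  Polynomials of \<^theory>\<open>HOL-Algebra.Polynomials\<close> are coefficient lists and the empty list is the
  zero polynomial.  The coefficients are central, so the side on which they act in the
  evaluation does not matter.
\<close>

definition algebraic_over_center :: "('a, 'b) ring_scheme \<Rightarrow> bool" where
  "algebraic_over_center R \<longleftrightarrow>
     (\<forall>x \<in> carrier R. \<exists>p \<in> carrier (univ_poly R (ring_center R)).
        p \<noteq> [] \<and> ring.eval R p x = \<zero>\<^bsub>R\<^esub>)"

text \<open>
  \<open>\<surd>(dim\<^sub>F D)\<close> for a division ring \<open>D\<close> that is finite-dimensional over its center \<open>F\<close>.  The
  dimension is then a perfect square, so that no rounding takes place in \<^const>\<open>floor_sqrt\<close>.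
\<close>

definition sqrt_dim_over_center :: "('a, 'b) ring_scheme \<Rightarrow> nat" where
  "sqrt_dim_over_center R = floor_sqrt (ring.dim R (ring_center R) (carrier R))"

end

theory Submission
  imports Defs
begin

text \<open>
  Write \<open>F\<close> for the center of \<open>D\<close>.  Modulo commutators a matrix over \<open>D\<close> is determined by its
  trace modulo \<open>[D, D]\<close>, and the scalar matrix of \<open>c \<in> F\<close> has trace \<open>n c\<close>.  Since \<open>n\<close> is
  invertible in \<open>D\<close>, everything reduces to the case \<open>n = 1\<close>, that is, to \<open>D = F + [D, D]\<close>
  (lemma \<open>mat_eq_center_plus_commutators\<close>).

  Let \<open>x \<in> D\<close> have degree \<open>m\<close> over \<open>F\<close>.  By Wedderburn, its minimal polynomial splits over
  \<open>D\<close> into linear factors \<open>t - z\<^sub>i\<close> with conjugates \<open>z\<^sub>i\<close> of \<open>x\<close>.  Comparing second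
  coefficients shows that \<open>z\<^sub>1 + \<dots> + z\<^sub>m\<close> is central.  But
  \<open>a x a\<^sup>-\<^sup>1 - x = [a x, a\<^sup>-\<^sup>1]\<close>, so this sum is \<open>m x\<close> modulo \<open>[D, D]\<close>
  (lemma \<open>minimal_relation_trace\<close>).  Whenever \<open>m\<close> is invertible in \<open>D\<close>, dividing by \<open>m\<close> puts
  \<open>x\<close> into \<open>F + [D, D]\<close>.

  In characteristic zero this always applies.  In characteristic \<open>p\<close> and finite dimension it
  suffices that \<open>m\<close> divides \<open>\<surd>(dim\<^sub>F D)\<close> (lemma \<open>degree_dvd_sqrt_dim\<close>): a maximal commuting set
  \<open>K\<close> containing \<open>x\<close> is a field with \<open>dim\<^sub>F D = (dim\<^sub>F K)\<^sup>2\<close>, and \<open>m = dim\<^sub>F F(x)\<close> divides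
  \<open>dim\<^sub>F K\<close>.

  Both Wedderburn's factorization and the dimension formula rest on one minimal-support argument
  (lemma \<open>ex_centralizing_vector\<close>).  Polynomials over \<open>D\<close> appear only as coefficient functions
  that are evaluated with the coefficients on the left; no product of polynomials is formed
  beyond multiplication by a linear factor.
\<close>

section \<open>Sums of commutators and centralizers\<close>

inductive_set commutator_span :: "'a::ring set" where
  zero: "0 \<in> commutator_span"
| add_commutator: "k \<in> commutator_span \<Longrightarrow> k + (a * b - b * a) \<in> commutator_span"

lemma commutator_in_span: "a * b - b * a \<in> commutator_span"
  using add_commutator[OF zero] by simp

lemma commutator_span_add:
  assumes "k \<in> commutator_span" "l \<in> commutator_span"
  shows "k + l \<in> commutator_span"
  using assms(2,1)
proof (induction l)
  case (add_commutator l a b)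
  then show ?case
    using commutator_span.add_commutator[of "k + l" a b] by (simp add: add.assoc)
qed simp

lemma commutator_span_uminus:
  assumes "k \<in> commutator_span"
  shows "- k \<in> commutator_span"
  using assms
proof (induction k)
  case (add_commutator k a b)
  have "- (k + (a * b - b * a)) = - k + (b * a - a * b)" by simp
  then show ?case
    using add_commutator.IH commutator_span.add_commutator by metis
qed (simp add: zero)

lemma commutator_span_diff:
  assumes "k \<in> commutator_span" "l \<in> commutator_span"
  shows "k - l \<in> commutator_span"
  using commutator_span_add[OF assms(1) commutator_span_uminus[OF assms(2)]] by simp

definition centralizer :: "'a::ring set \<Rightarrow> 'a set" where
  "centralizer S = {z. \<forall>s\<in>S. z * s = s * z}"

lemma centralizerD: "z \<in> centralizer S \<Longrightarrow> s \<in> S \<Longrightarrow> z * s = s * z"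
  by (simp add: centralizer_def)

abbreviation center :: "'a::ring set" where
  "center \<equiv> centralizer UNIV"

lemma center_subset_centralizer: "center \<subseteq> centralizer S"
  by (auto simp: centralizer_def)

text \<open>A central factor can be moved into the first entry of each commutator,
  \<open>z(ab - ba) = (za)b - b(za)\<close>, so \<open>[D, D]\<close> is a subspace over the center.\<close>

lemma commutator_span_central_mult:
  assumes "z \<in> center" "k \<in> commutator_span"
  shows "z * k \<in> commutator_span"
  using assms(2)
proof (induction k)
  case (add_commutator k a b)
  have "z * (k + (a * b - b * a)) = z * k + ((z * a) * b - b * (z * a))"
    using centralizerD[OF assms(1), of b]
    by (simp add: distrib_left right_diff_distrib mult.assoc [symmetric])
  then show ?case
    using add_commutator.IH commutator_span.add_commutator by metis
qed (simp add: zero)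

lemma centralizer_zero: "0 \<in> centralizer S"
  and centralizer_add: "a \<in> centralizer S \<Longrightarrow> b \<in> centralizer S \<Longrightarrow> a + b \<in> centralizer S"
  and centralizer_uminus: "a \<in> centralizer S \<Longrightarrow> - a \<in> centralizer S"
  and centralizer_diff: "a \<in> centralizer S \<Longrightarrow> b \<in> centralizer S \<Longrightarrow> a - b \<in> centralizer S"
  by (auto simp: centralizer_def algebra_simps)

lemma centralizer_mult:
  assumes "a \<in> centralizer S" "b \<in> centralizer S"
  shows "a * b \<in> centralizer S"
proof -
  have "a * b * s = s * (a * b)" if "s \<in> S" for s
    using that assms centralizerD[of a S s] centralizerD[of b S s]
    by (metis mult.assoc)
  then show ?thesis by (auto simp: centralizer_def)
qed

lemma centralizer_one: "(1::'a::ring_1) \<in> centralizer S"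
  by (simp add: centralizer_def)

lemma centralizer_of_nat: "(of_nat m::'a::ring_1) \<in> centralizer S"
  by (induction m) (auto intro: centralizer_zero centralizer_one centralizer_add)

lemma centralizer_inverse:
  fixes a :: "'a::division_ring"
  assumes "a \<in> centralizer S"
  shows "inverse a \<in> centralizer S"
proof (cases "a = 0")
  case False
  have "inverse a * s = s * inverse a" if "s \<in> S" for s
  proof -
    have "inverse a * s = inverse a * (s * a) * inverse a"
      using False by (simp add: mult.assoc)
    also have "\<dots> = inverse a * (a * s) * inverse a"
      using centralizerD[OF assms that] by simp
    also have "\<dots> = s * inverse a"
      using False by (simp add: mult.assoc [symmetric])
    finally show ?thesis .
  qed
  then show ?thesis by (auto simp: centralizer_def)
qed (simp add: centralizer_zero)

section \<open>Vectors with entries in a centralizer\<close>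

text \<open>The minimal-support argument behind Artin's independence theorem.  A nonzero vector \<open>w\<close> of
  \<open>V\<close> with the fewest nonzero entries, scaled to have an entry \<open>1\<close>, must centralize \<open>S\<close>: the
  vector \<open>w s - s w\<close> again lies in \<open>V\<close> but vanishes at that entry too, so it is zero.
  It is the common source of the three linear independence statements below.\<close>

lemma ex_centralizing_vector:
  fixes V :: "('i \<Rightarrow> 'a::division_ring) set"
  assumes "finite I"
    and diff: "\<And>v w. v \<in> V \<Longrightarrow> w \<in> V \<Longrightarrow> (\<lambda>i. v i - w i) \<in> V"
    and left: "\<And>v a. v \<in> V \<Longrightarrow> (\<lambda>i. a * v i) \<in> V"
    and right: "\<And>v s. v \<in> V \<Longrightarrow> s \<in> S \<Longrightarrow> (\<lambda>i. v i * s) \<in> V"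
    and "v0 \<in> V" "i0 \<in> I" "v0 i0 \<noteq> 0"
  shows "\<exists>w\<in>V. (\<exists>j\<in>I. w j \<noteq> 0) \<and> (\<forall>i\<in>I. w i \<in> centralizer S)"
proof -
  let ?supp = "\<lambda>v. {i\<in>I. v i \<noteq> 0}"
  obtain v where v: "v \<in> V \<and> ?supp v \<noteq> {}"
    and least: "\<And>w. w \<in> V \<and> ?supp w \<noteq> {} \<Longrightarrow> card (?supp v) \<le> card (?supp w)"
    using ex_has_least_nat[of "\<lambda>v. v \<in> V \<and> ?supp v \<noteq> {}" v0 "\<lambda>v. card (?supp v)"] assms(5-7)
    by blast
  then obtain j where j: "j \<in> I" "v j \<noteq> 0" by auto
  define w where "w = (\<lambda>i. inverse (v j) * v i)"
  have w: "w \<in> V" "w j = 1"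
    using v left j by (auto simp: w_def)
  have "w i * s = s * w i" if "s \<in> S" "i \<in> I" for s i
  proof -
    define u where "u = (\<lambda>i. w i * s - s * w i)"
    have "u \<in> V"
      using diff[OF right[OF w(1) that(1)] left[OF w(1), of s]] by (simp add: u_def)
    moreover have "?supp u \<subset> ?supp v"
    proof
      show "?supp u \<subseteq> ?supp v" by (auto simp: u_def w_def)
      have "j \<in> ?supp v - ?supp u" using j w(2) by (auto simp: u_def)
      then show "?supp u \<noteq> ?supp v" by blast
    qed
    then have "card (?supp u) < card (?supp v)"
      using assms(1) by (simp add: psubset_card_mono)
    ultimately have "?supp u = {}"
      using least[of u] by (meson not_le)
    then show ?thesis using that by (auto simp: u_def)
  qed
  then show ?thesis
    using w j by (intro bexI[of _ w] conjI bexI[of _ j]) (auto simp: centralizer_def)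
qed

section \<open>Wedderburn's factorization and the trace\<close>

lemma conj_power:
  fixes a :: "'a::division_ring"
  assumes "a \<noteq> 0"
  shows "(a * x * inverse a) ^ i = a * x ^ i * inverse a"
proof (induction i)
  case (Suc i)
  have "(a * x * inverse a) ^ Suc i = a * x * (inverse a * a) * x ^ i * inverse a"
    using Suc by (simp add: mult.assoc)
  then show ?case using assms by (simp add: mult.assoc)
qed (use assms in simp)

lemma conj_minus_in_commutator_span:
  fixes a :: "'a::division_ring"
  assumes "a \<noteq> 0"
  shows "a * x * inverse a - x \<in> commutator_span"
  using commutator_in_span[of "a * x" "inverse a"] assms
  by (simp add: mult.assoc [symmetric])

definition conj_class :: "'a::division_ring \<Rightarrow> 'a set" where
  "conj_class x = {a * x * inverse a | a. a \<noteq> 0}"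

lemma conj_class_conj:
  assumes "y \<in> conj_class x" "a \<noteq> 0"
  shows "a * y * inverse a \<in> conj_class x"
proof -
  obtain b where b: "b \<noteq> 0" "y = b * x * inverse b"
    using assms(1) by (auto simp: conj_class_def)
  then have "a * y * inverse a = (a * b) * x * inverse (a * b)"
    using assms(2) by (simp add: nonzero_inverse_mult_distrib mult.assoc)
  then show ?thesis using assms(2) b(1) by (auto simp: conj_class_def)
qed

definition powers_independent :: "'a::division_ring \<Rightarrow> nat \<Rightarrow> bool" where
  "powers_independent x m \<longleftrightarrow>
     (\<forall>c. (\<forall>i<m. c i \<in> center) \<longrightarrow> (\<Sum>i<m. c i * x ^ i) = 0 \<longrightarrow> (\<forall>i<m. c i = 0))"

text \<open>The vanishing condition on left coefficients \<open>c\<^sub>i\<close> is preserved when they are multiplied on the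
  right by \<open>s\<close>, because \<open>s y\<^sup>i = (s y s\<^sup>-\<^sup>1)\<^sup>i s\<close> moves \<open>s\<close> past the powers at the cost of a
  conjugation.  By minimal support, a nonzero solution would yield a nonzero one with central
  coefficients, a relation for \<open>x\<close> of degree less than \<open>m\<close>.\<close>

lemma conj_class_vanishing_imp_zero:
  fixes x :: "'a::division_ring"
  assumes "powers_independent x m"
    and "\<And>y. y \<in> conj_class x \<Longrightarrow> (\<Sum>i<m. c i * y ^ i) = 0" "i < m"
  shows "c i = 0"
proof (rule ccontr)
  assume "c i \<noteq> 0"
  define V where "V = {c. \<forall>y\<in>conj_class x. (\<Sum>i<m. c i * y ^ i) = 0}"
  have V_right: "(\<lambda>i. v i * s) \<in> V" if "v \<in> V" for v s
  proof (cases "s = 0")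
    case False
    have "(\<Sum>i<m. v i * s * y ^ i) = 0" if y: "y \<in> conj_class x" for y
    proof -
      have "s * y ^ i = (s * y * inverse s) ^ i * s" for i
        using False by (simp only: conj_power[OF False]) (simp add: mult.assoc)
      then have "(\<Sum>i<m. v i * s * y ^ i) = (\<Sum>i<m. v i * (s * y * inverse s) ^ i) * s"
        by (simp add: sum_distrib_right mult.assoc)
      also have "\<dots> = 0"
        using \<open>v \<in> V\<close> conj_class_conj[OF y False] by (simp add: V_def)
      finally show ?thesis .
    qed
    then show ?thesis by (simp add: V_def)
  qed (simp add: V_def)
  have V_diff: "(\<lambda>i. v i - w i) \<in> V" if "v \<in> V" "w \<in> V" for v w
    using that by (simp add: V_def left_diff_distrib sum_subtractf)
  have V_left: "(\<lambda>i. a * v i) \<in> V" if "v \<in> V" for v a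
    using that by (simp add: V_def mult.assoc sum_distrib_left [symmetric])
  have c_in: "c \<in> V" using assms(2) by (simp add: V_def)
  have "i \<in> {..<m}" using assms(3) by simp
  from ex_centralizing_vector[OF finite_lessThan V_diff V_left V_right c_in this \<open>c i \<noteq> 0\<close>]
  obtain w j where w: "w \<in> V" "j \<in> {..<m}" "w j \<noteq> 0" "\<forall>i\<in>{..<m}. w i \<in> center"
    by blast
  have "x \<in> conj_class x"
    by (auto simp: conj_class_def intro: exI[of _ 1])
  then have "(\<Sum>i<m. w i * x ^ i) = 0" using w(1) by (simp add: V_def)
  then show False using assms(1) w by (auto simp: powers_independent_def)
qed

text \<open>A set \<open>Y\<close> of conjugates of \<open>x\<close> that is independent for polynomials of degree less than \<open>r\<close>,
  with the monic polynomial \<open>h\<close> of degree \<open>r\<close> that vanishes on it.  In Wedderburn's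
  factorization \<open>h = (t - z\<^sub>r) \<dots> (t - z\<^sub>1)\<close> with conjugates \<open>z\<^sub>i\<close> of \<open>x\<close>; the last
  clause keeps of this product only what is needed, its second coefficient
  \<open>- (z\<^sub>1 + \<dots> + z\<^sub>r)\<close>, which is \<open>- r x\<close> modulo \<open>[D, D]\<close>; for \<open>r = 0\<close>, where there is
  no second coefficient, \<open>0\<close> takes its place.\<close>

definition conj_interpolant :: "'a::division_ring \<Rightarrow> nat \<Rightarrow> 'a set \<Rightarrow> (nat \<Rightarrow> 'a) \<Rightarrow> bool" where
  "conj_interpolant x r Y h \<longleftrightarrow>
    Y \<subseteq> conj_class x \<and> h r = 1 \<and> (\<forall>i>r. h i = 0) \<and>
    (\<forall>y\<in>Y. (\<Sum>i\<le>r. h i * y ^ i) = 0) \<and>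
    (\<forall>g. (\<forall>y\<in>Y. (\<Sum>i<r. g i * y ^ i) = 0) \<longrightarrow> (\<forall>i<r. g i = 0)) \<and>
    (case r of 0 \<Rightarrow> 0 | Suc k \<Rightarrow> h k) + of_nat r * x \<in> commutator_span"

text \<open>As long as \<open>r < m\<close>, the polynomial \<open>h\<close> cannot vanish at every conjugate.  If \<open>h(y') = e \<noteq> 0\<close>,
  then \<open>(t - e y' e\<^sup>-\<^sup>1) h\<close> has the value \<open>e y' - (e y' e\<^sup>-\<^sup>1) e = 0\<close> at \<open>y'\<close> and still
  vanishes on \<open>Y\<close>; \<open>y'\<close> is added to \<open>Y\<close>, and the second coefficient changes by minus a
  conjugate of \<open>x\<close>.\<close>

lemma ex_conj_interpolant:
  fixes x :: "'a::division_ring"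
  assumes "powers_independent x m" "r \<le> m"
  shows "\<exists>Y h. conj_interpolant x r Y h"
  using assms(2)
proof (induction r)
  case 0
  have "conj_interpolant x 0 {} (\<lambda>i. if i = 0 then 1 else 0)"
    by (simp add: conj_interpolant_def commutator_span.zero)
  then show ?case by blast
next
  case (Suc r)
  then obtain Y h where "conj_interpolant x r Y h" by auto
  then have Y: "Y \<subseteq> conj_class x" and h: "h r = 1" "\<And>i. i > r \<Longrightarrow> h i = 0"
    and vanish: "\<And>y. y \<in> Y \<Longrightarrow> (\<Sum>i\<le>r. h i * y ^ i) = 0"
    and indep: "\<And>g. (\<forall>y\<in>Y. (\<Sum>i<r. g i * y ^ i) = 0) \<Longrightarrow> (\<forall>i<r. g i = 0)"
    and tr: "(case r of 0 \<Rightarrow> 0 | Suc k \<Rightarrow> h k) + of_nat r * x \<in> commutator_span"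
    unfolding conj_interpolant_def by blast+
  let ?ev = "\<lambda>y. \<Sum>i\<le>r. h i * y ^ i"
  have "\<exists>y\<in>conj_class x. ?ev y \<noteq> 0"
  proof (rule ccontr)
    assume "\<not> ?thesis"
    moreover have "(\<Sum>i<m. h i * y ^ i) = ?ev y" for y
      by (rule sum.mono_neutral_right) (use Suc.prems h in auto)
    ultimately have "h r = 0"
      using conj_class_vanishing_imp_zero[OF assms(1), of h r] Suc.prems by simp
    then show False using h by simp
  qed
  then obtain y' where y': "y' \<in> conj_class x" "?ev y' \<noteq> 0" by blast
  define z where "z = ?ev y' * y' * inverse (?ev y')"
  have z: "z \<in> conj_class x"
    using conj_class_conj[OF y'] by (simp add: z_def)
  \<comment> \<open>Left multiplication of the polynomial h by t - z.\<close>
  define h' where "h' = (\<lambda>i. (case i of 0 \<Rightarrow> 0 | Suc k \<Rightarrow> h k) - z * h i)"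
  have ev': "(\<Sum>i\<le>Suc r. h' i * y ^ i) = ?ev y * y - z * ?ev y" for y
  proof -
    have "(\<Sum>i\<le>Suc r. h' i * y ^ i) =
        (\<Sum>i\<le>Suc r. (case i of 0 \<Rightarrow> 0 | Suc k \<Rightarrow> h k) * y ^ i) - (\<Sum>i\<le>Suc r. z * h i * y ^ i)"
      by (simp add: h'_def left_diff_distrib sum_subtractf)
    also have "(\<Sum>i\<le>Suc r. (case i of 0 \<Rightarrow> 0 | Suc k \<Rightarrow> h k) * y ^ i) = ?ev y * y"
      by (simp add: sum.atMost_Suc_shift sum_distrib_right power_commutes mult.assoc del: sum.atMost_Suc)
    also have "(\<Sum>i\<le>Suc r. z * h i * y ^ i) = z * ?ev y"
      using h(2)[of "Suc r"] by (simp add: sum_distrib_left mult.assoc)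
    finally show ?thesis .
  qed
  have "(\<Sum>i\<le>Suc r. h' i * y ^ i) = 0" if "y \<in> insert y' Y" for y
    using that vanish y'(2) unfolding ev' by (auto simp: z_def mult.assoc)
  moreover have "\<forall>i<Suc r. g i = 0"
    if g: "\<forall>y\<in>insert y' Y. (\<Sum>i<Suc r. g i * y ^ i) = 0" for g
  proof -
    \<comment> \<open>Subtracting a multiple of h removes the top coefficient of g without changing
      its values on Y.\<close>
    define g' where "g' = (\<lambda>i. g i - g r * h i)"
    have ev_g': "(\<Sum>i<r. g' i * y ^ i) = (\<Sum>i<Suc r. g i * y ^ i) - g r * ?ev y" for y
    proof -
      have "(\<Sum>i<Suc r. g' i * y ^ i) = (\<Sum>i<Suc r. g i * y ^ i) - g r * ?ev y"
        unfolding lessThan_Suc_atMost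
        by (simp add: g'_def left_diff_distrib sum_subtractf sum_distrib_left mult.assoc)
      moreover have "g' r = 0" using h by (simp add: g'_def)
      ultimately show ?thesis by simp
    qed
    then have g'0: "\<forall>i<r. g' i = 0"
      using indep[of g'] g vanish by simp
    then have "g r * ?ev y' = 0"
      using ev_g'[of y'] g by simp
    then have "g r = 0" using y' by simp
    then show ?thesis using g'0 by (auto simp: g'_def less_Suc_eq)
  qed
  moreover have "h' (Suc r) = 1" "\<forall>i>Suc r. h' i = 0"
    using h by (auto simp: h'_def split: nat.split)
  moreover have "h' r + of_nat (Suc r) * x \<in> commutator_span"
  proof -
    obtain a where "a \<noteq> 0" "z = a * x * inverse a"
      using z by (auto simp: conj_class_def)
    then have "z - x \<in> commutator_span"
      using conj_minus_in_commutator_span by blast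
    from commutator_span_diff[OF tr this] show ?thesis
      using h(1) by (simp add: h'_def algebra_simps)
  qed
  ultimately have "conj_interpolant x (Suc r) (insert y' Y) h'"
    using Y y'(1) unfolding conj_interpolant_def nat.case insert_subset by blast
  then show ?case by blast
qed

text \<open>The minimal polynomial of \<open>x\<close> over the center, of degree \<open>m\<close>, given by its coefficients.\<close>

definition minimal_relation :: "'a::division_ring \<Rightarrow> nat \<Rightarrow> (nat \<Rightarrow> 'a) \<Rightarrow> bool" where
  "minimal_relation x m f \<longleftrightarrow> powers_independent x m \<and> (\<forall>i. f i \<in> center) \<and> f m = 1 \<and>
     (\<Sum>i\<le>m. f i * x ^ i) = 0"

lemma minimal_relation_degree_pos: "minimal_relation x m f \<Longrightarrow> m > 0"
  by (cases m) (auto simp: minimal_relation_def)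

lemma ex_minimal_relation:
  fixes x :: "'a::division_ring"
  assumes "\<not> powers_independent x N"
  obtains m f where "minimal_relation x m f"
proof -
  define M where "M = (LEAST N. \<not> powers_independent x N)"
  have M: "\<not> powers_independent x M"
    unfolding M_def by (rule LeastI[of _ N]) (rule assms)
  then have "M \<noteq> 0" by (auto simp: powers_independent_def)
  then obtain m where m: "M = Suc m" by (cases M) auto
  have indep: "powers_independent x m"
    using not_less_Least[of m "\<lambda>N. \<not> powers_independent x N"] m
    by (auto simp: M_def [symmetric])
  obtain c where c: "\<forall>i<Suc m. c i \<in> center" "(\<Sum>i<Suc m. c i * x ^ i) = 0" "\<exists>i<Suc m. c i \<noteq> 0"
    using M unfolding m powers_independent_def by blast
  have "c m \<noteq> 0"
  proof
    assume "c m = 0"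
    then have "\<forall>i<m. c i = 0"
      using indep c(1,2) by (simp add: powers_independent_def)
    then show False using c(3) \<open>c m = 0\<close> by (auto simp: less_Suc_eq)
  qed
  define f where "f = (\<lambda>i. if i \<le> m then inverse (c m) * c i else 0)"
  have "\<forall>i. f i \<in> center"
    using c(1) by (auto simp: f_def less_Suc_eq_le centralizer_zero
        intro: centralizer_mult centralizer_inverse)
  moreover have "(\<Sum>i\<le>m. f i * x ^ i) = inverse (c m) * (\<Sum>i<Suc m. c i * x ^ i)"
    unfolding lessThan_Suc_atMost by (simp add: f_def sum_distrib_left mult.assoc)
  ultimately have "minimal_relation x m f"
    using indep c(2) \<open>c m \<noteq> 0\<close> by (simp add: minimal_relation_def f_def)
  then show ?thesis using that by blast
qed

lemma conj_class_root:
  fixes x :: "'a::division_ring"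
  assumes "minimal_relation x m f" "y \<in> conj_class x"
  shows "(\<Sum>i\<le>m. f i * y ^ i) = 0"
proof -
  obtain a where a: "a \<noteq> 0" "y = a * x * inverse a"
    using assms(2) by (auto simp: conj_class_def)
  have "f i * y ^ i = a * (f i * x ^ i) * inverse a" for i
    using assms(1) centralizerD[of "f i" UNIV a] a
    by (simp add: minimal_relation_def conj_power mult.assoc [symmetric])
  then have "(\<Sum>i\<le>m. f i * y ^ i) = a * (\<Sum>i\<le>m. f i * x ^ i) * inverse a"
    by (simp add: sum_distrib_left sum_distrib_right)
  then show ?thesis using assms(1) by (simp add: minimal_relation_def)
qed

text \<open>The minimal polynomial \<open>f\<close> has central coefficients, so it vanishes at all conjugates of \<open>x\<close>.
  Its difference with the monic \<open>h\<close> of an independent set of \<open>m\<close> conjugates has degree less than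
  \<open>m\<close> and vanishes on that set.  Hence \<open>f = h\<close>, and the second coefficient of \<open>f\<close> is
  \<open>- m x\<close> modulo \<open>[D, D]\<close>.\<close>

lemma minimal_relation_trace:
  fixes x :: "'a::division_ring"
  assumes "minimal_relation x m f"
  shows "f (m - 1) + of_nat m * x \<in> commutator_span"
proof -
  obtain k where k: "m = Suc k"
    using minimal_relation_degree_pos[OF assms] by (cases m) auto
  have "powers_independent x m" using assms by (simp add: minimal_relation_def)
  then obtain Y h where "conj_interpolant x m Y h"
    using ex_conj_interpolant by blast
  then have Y: "Y \<subseteq> conj_class x" and h: "h m = 1"
    and vanish: "\<And>y. y \<in> Y \<Longrightarrow> (\<Sum>i\<le>m. h i * y ^ i) = 0"
    and indep: "\<And>g. (\<forall>y\<in>Y. (\<Sum>i<m. g i * y ^ i) = 0) \<Longrightarrow> (\<forall>i<m. g i = 0)"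
    and tr: "h k + of_nat m * x \<in> commutator_span"
    unfolding conj_interpolant_def k nat.case by blast+
  have "(\<Sum>i<m. (f i - h i) * y ^ i) = 0" if "y \<in> Y" for y
  proof -
    have "(\<Sum>i\<le>m. (f i - h i) * y ^ i) = 0"
      using conj_class_root[OF assms, of y] vanish[OF that] that Y
      by (auto simp: left_diff_distrib sum_subtractf)
    then show ?thesis
      using assms h by (simp add: minimal_relation_def lessThan_Suc_atMost [symmetric])
  qed
  then have "\<forall>i<m. f i - h i = 0" by (intro indep) blast
  then show ?thesis using tr k by simp
qed

lemma center_plus_commutators_of_degree:
  fixes x :: "'a::division_ring"
  assumes "minimal_relation x m f" "of_nat m \<noteq> (0::'a)"
  shows "\<exists>z\<in>center. x - z \<in> commutator_span"
proof -
  define q where "q = inverse (of_nat m :: 'a)"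
  have q: "q \<in> center" unfolding q_def
    by (intro centralizer_inverse centralizer_of_nat)
  have "q * (f (m - 1) + of_nat m * x) = x - (- (q * f (m - 1)))"
    using assms(2) by (simp add: q_def distrib_left mult.assoc [symmetric])
  moreover have "- (q * f (m - 1)) \<in> center"
    using q assms(1) by (simp add: minimal_relation_def centralizer_mult centralizer_uminus)
  ultimately show ?thesis
    using commutator_span_central_mult[OF q minimal_relation_trace[OF assms(1)]] by metis
qed

section \<open>Self-centralizing subsets\<close>

text \<open>Gaussian elimination.  The product is a parameter so that both \<open>a b\<close> and the opposite product
  \<open>b a\<close> are covered: systems with the unknowns on the left and on the right are both needed.\<close>

lemma nontrivial_kernel_of_wide_system:
  fixes M :: "nat \<Rightarrow> 'j \<Rightarrow> 'a::division_ring" and mul :: "'a \<Rightarrow> 'a \<Rightarrow> 'a"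
  assumes assoc: "\<And>a b c. mul (mul a b) c = mul a (mul b c)"
    and distl: "\<And>a b c. mul (a + b) c = mul a c + mul b c"
    and distr: "\<And>a b c. mul a (b + c) = mul a b + mul a c"
    and inv: "\<And>a. a \<noteq> 0 \<Longrightarrow> mul (inverse a) a = 1" and one: "\<And>a. mul a 1 = a"
    and "finite J" "r < card J"
  shows "\<exists>c. (\<exists>j\<in>J. c j \<noteq> 0) \<and> (\<forall>i<r. (\<Sum>j\<in>J. mul (c j) (M i j)) = 0)"
proof -
  interpret l: additive "\<lambda>a. mul a c" for c by standard (rule distl)
  interpret r: additive "mul a" for a by standard (rule distr)
  show ?thesis using assms(6,7)
  proof (induction r arbitrary: J M)
    case 0
    then obtain j where "j \<in> J" by (metis card_gt_0_iff ex_in_conv)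
    then show ?case by (intro exI[of _ "\<lambda>_. 1"]) auto
  next
    case (Suc r)
    show ?case
    proof (cases "\<forall>j\<in>J. M r j = 0")
      case True
      obtain c where "\<exists>j\<in>J. c j \<noteq> 0" "\<forall>i<r. (\<Sum>j\<in>J. mul (c j) (M i j)) = 0"
        using Suc.IH[of J M] Suc.prems by auto
      then show ?thesis using True by (intro exI[of _ c]) (auto simp: less_Suc_eq r.zero)
    next
      case False
      then obtain p where p: "p \<in> J" "M r p \<noteq> 0" by blast
      define q where "q = inverse (M r p)"
      define J' where "J' = J - {p}"
      have J': "finite J'" "r < card J'" "p \<notin> J'" "J = insert p J'"
        using Suc.prems p by (auto simp: J'_def)
      obtain c where c: "\<exists>j\<in>J'. c j \<noteq> 0"
        "\<And>i. i < r \<Longrightarrow> (\<Sum>j\<in>J'. mul (c j) (M i j - mul (mul (M r j) q) (M i p))) = 0"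
        using Suc.IH[of J' "\<lambda>i j. M i j - mul (mul (M r j) q) (M i p)"] J' by blast
      define t where "t = (\<Sum>j\<in>J'. mul (c j) (M r j))"
      define d where "d = (\<lambda>j. if j = p then - mul t q else c j)"
      have d: "(\<Sum>j\<in>J. mul (d j) (M i j)) =
          (\<Sum>j\<in>J'. mul (c j) (M i j)) - mul (mul t q) (M i p)" for i
      proof -
        have "(\<Sum>j\<in>J'. mul (d j) (M i j)) = (\<Sum>j\<in>J'. mul (c j) (M i j))"
          using J' by (intro sum.cong) (auto simp: d_def)
        then show ?thesis using J' by (simp add: d_def l.minus)
      qed
      have "(\<Sum>j\<in>J. mul (d j) (M i j)) = 0" if "i < Suc r" for i
      proof (cases "i = r")
        case True
        have "mul (mul t q) (M r p) = t"
          using p inv one assoc by (simp add: q_def)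
        then show ?thesis using True d by (simp add: t_def)
      next
        case False
        have "mul (mul t q) (M i p) = (\<Sum>j\<in>J'. mul (c j) (mul (mul (M r j) q) (M i p)))"
          by (simp add: t_def l.sum assoc)
        then show ?thesis
          using c(2)[of i] d False that by (simp add: r.diff sum_subtractf)
      qed
      moreover have "\<exists>j\<in>J. d j \<noteq> 0" using c(1) J' by (auto simp: d_def)
      ultimately show ?thesis by blast
    qed
  qed
qed

definition left_basis :: "'a::ring set \<Rightarrow> 'a set \<Rightarrow> nat \<Rightarrow> (nat \<Rightarrow> 'a) \<Rightarrow> bool" where
  "left_basis K E n b \<longleftrightarrow> (\<forall>i<n. b i \<in> E) \<and>
     (\<forall>y\<in>E. \<exists>c. (\<forall>i<n. c i \<in> K) \<and> y = (\<Sum>i<n. c i * b i)) \<and>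
     (\<forall>c. (\<forall>i<n. c i \<in> K) \<longrightarrow> (\<Sum>i<n. c i * b i) = 0 \<longrightarrow> (\<forall>i<n. c i = 0))"

text \<open>This equality \<open>dim\<^sub>K D = dim\<^sub>F K\<close>, where \<open>F\<close> is the center, makes \<open>dim\<^sub>F D\<close> a perfect square.
  With an \<open>F\<close>-basis \<open>b\<^sub>i\<close> of \<open>K\<close> and a left \<open>K\<close>-basis
  \<open>e\<^sub>j\<close> of \<open>D\<close>, the matrix \<open>b\<^sub>i e\<^sub>j\<close> over \<open>D\<close> has no kernel on either side, so it is square.
  A left kernel vector satisfies \<open>\<Sum> c\<^sub>j y e\<^sub>j = 0\<close> for all \<open>y \<in> K\<close>; by minimal support it can be
  taken with entries centralizing \<open>K\<close>, that is, in \<open>K\<close>, and \<open>y = 1\<close> contradicts the independence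
  of the \<open>e\<^sub>j\<close>.  A right kernel vector satisfies \<open>\<Sum> b\<^sub>i y a\<^sub>i = 0\<close> for all \<open>y \<in> D\<close>; it can be
  taken with central entries, which contradicts the independence of the \<open>b\<^sub>i\<close>.\<close>

lemma self_centralizing_left_dim_eq:
  fixes K :: "'a::division_ring set"
  assumes K: "centralizer K = K"
    and b: "left_basis center K m b" and e: "left_basis K UNIV s e"
  shows "s = m"
proof (rule antisym)
  have b_in: "\<And>i. i < m \<Longrightarrow> b i \<in> K"
    and b_span: "\<And>y. y \<in> K \<Longrightarrow> \<exists>c. (\<forall>i<m. c i \<in> center) \<and> y = (\<Sum>i<m. c i * b i)"
    and b_indep: "\<And>c. (\<forall>i<m. c i \<in> center) \<Longrightarrow> (\<Sum>i<m. c i * b i) = 0 \<Longrightarrow> \<forall>i<m. c i = 0"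
    using b unfolding left_basis_def by blast+
  have e_span: "\<And>y. \<exists>c. (\<forall>j<s. c j \<in> K) \<and> y = (\<Sum>j<s. c j * e j)"
    and e_indep: "\<And>c. (\<forall>j<s. c j \<in> K) \<Longrightarrow> (\<Sum>j<s. c j * e j) = 0 \<Longrightarrow> \<forall>j<s. c j = 0"
    using e unfolding left_basis_def by blast+
  show "s \<le> m"
  proof (rule ccontr)
    assume "\<not> s \<le> m"
    then obtain c where c: "\<exists>j\<in>{..<s}. c j \<noteq> 0"
      "\<And>i. i < m \<Longrightarrow> (\<Sum>j<s. c j * (b i * e j)) = 0"
      using nontrivial_kernel_of_wide_system[of "(*)" "{..<s}" m "\<lambda>i j. b i * e j"]
      by (auto simp: mult.assoc distrib_left distrib_right)
    define V where "V = {c. \<forall>y\<in>K. (\<Sum>j<s. c j * y * e j) = 0}"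
    have c_in: "c \<in> V"
    proof -
      have "(\<Sum>j<s. c j * y * e j) = 0" if y: "y \<in> K" for y
      proof -
        obtain a where a: "\<forall>i<m. a i \<in> center" "y = (\<Sum>i<m. a i * b i)"
          using b_span[OF y] by blast
        have "(\<Sum>j<s. c j * y * e j) = (\<Sum>j<s. \<Sum>i<m. c j * (a i * b i) * e j)"
          by (simp add: a(2) sum_distrib_left sum_distrib_right)
        also have "\<dots> = (\<Sum>i<m. \<Sum>j<s. c j * (a i * b i) * e j)"
          by (rule sum.swap)
        also have "\<dots> = (\<Sum>i<m. a i * (\<Sum>j<s. c j * (b i * e j)))"
        proof (rule sum.cong[OF refl])
          fix i assume "i \<in> {..<m}"
          then have "c j * (a i * b i) * e j = a i * (c j * (b i * e j))" for j
            using a(1) centralizerD[of "a i" UNIV "c j"] by (simp add: mult.assoc [symmetric])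
          then show "(\<Sum>j<s. c j * (a i * b i) * e j) = a i * (\<Sum>j<s. c j * (b i * e j))"
            by (simp add: sum_distrib_left)
        qed
        also have "\<dots> = 0" using c(2) by simp
        finally show ?thesis .
      qed
      then show ?thesis by (simp add: V_def)
    qed
    have V_right: "(\<lambda>i. v i * t) \<in> V" if "v \<in> V" "t \<in> K" for v t
    proof -
      have "t * y \<in> K" if "y \<in> K" for y
        using centralizer_mult[of t K y] \<open>t \<in> K\<close> that K by simp
      then have "(\<Sum>j<s. v j * (t * y) * e j) = 0" if "y \<in> K" for y
        using \<open>v \<in> V\<close> that by (simp add: V_def)
      then show ?thesis by (simp add: V_def mult.assoc)
    qed
    have V_diff: "(\<lambda>i. v i - w i) \<in> V" if "v \<in> V" "w \<in> V" for v w
      using that by (simp add: V_def left_diff_distrib sum_subtractf)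
    have V_left: "(\<lambda>i. a * v i) \<in> V" if "v \<in> V" for v a
      using that by (simp add: V_def mult.assoc sum_distrib_left [symmetric])
    obtain j0 where "j0 \<in> {..<s}" "c j0 \<noteq> 0" using c(1) by blast
    from ex_centralizing_vector[OF finite_lessThan V_diff V_left V_right c_in this]
    obtain w j where w: "w \<in> V" "j \<in> {..<s}" "w j \<noteq> 0" "\<forall>i\<in>{..<s}. w i \<in> centralizer K"
      by blast
    have "(1::'a) \<in> K" using centralizer_one[of K] K by simp
    then have "(\<Sum>j<s. w j * e j) = 0" using w(1) by (force simp: V_def)
    moreover have "\<forall>j<s. w j \<in> K" using w(4) K by simp
    ultimately have "\<forall>j<s. w j = 0" by (intro e_indep)
    then show False using w(2,3) by simp
  qed
  show "m \<le> s"
  proof (rule ccontr)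
    assume "\<not> m \<le> s"
    then obtain a where a: "\<exists>i\<in>{..<m}. a i \<noteq> 0"
      "\<And>j. j < s \<Longrightarrow> (\<Sum>i<m. (b i * e j) * a i) = 0"
      using nontrivial_kernel_of_wide_system[of "\<lambda>x y. y * x" "{..<m}" s "\<lambda>j i. b i * e j"]
      by (auto simp: mult.assoc distrib_left distrib_right)
    define V where "V = {a. \<forall>y. (\<Sum>i<m. b i * y * a i) = 0}"
    have a_in: "a \<in> V"
    proof -
      have "(\<Sum>i<m. b i * y * a i) = 0" for y
      proof -
        obtain c where c: "\<forall>j<s. c j \<in> K" "y = (\<Sum>j<s. c j * e j)"
          using e_span by blast
        have "(\<Sum>i<m. b i * y * a i) = (\<Sum>i<m. \<Sum>j<s. b i * (c j * e j) * a i)"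
          by (simp add: c(2) sum_distrib_left sum_distrib_right)
        also have "\<dots> = (\<Sum>j<s. \<Sum>i<m. b i * (c j * e j) * a i)"
          by (rule sum.swap)
        also have "\<dots> = (\<Sum>j<s. c j * (\<Sum>i<m. (b i * e j) * a i))"
        proof (rule sum.cong[OF refl])
          fix j assume "j \<in> {..<s}"
          then have "b i * (c j * e j) * a i = c j * ((b i * e j) * a i)" if "i < m" for i
            using c(1) b_in[OF that] centralizerD[of "c j" K "b i"] K
            by (simp add: mult.assoc [symmetric])
          then show "(\<Sum>i<m. b i * (c j * e j) * a i) = c j * (\<Sum>i<m. (b i * e j) * a i)"
            by (simp add: sum_distrib_left)
        qed
        also have "\<dots> = 0" using a(2) by simp
        finally show ?thesis .
      qed
      then show ?thesis by (simp add: V_def)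
    qed
    have V_left: "(\<lambda>i. t * v i) \<in> V" if "v \<in> V" for v t
    proof -
      have "(\<Sum>i<m. b i * (y * t) * v i) = 0" for y
        using that by (simp add: V_def)
      then show ?thesis by (simp add: V_def mult.assoc)
    qed
    have V_diff: "(\<lambda>i. v i - w i) \<in> V" if "v \<in> V" "w \<in> V" for v w
      using that by (simp add: V_def right_diff_distrib sum_subtractf)
    have V_right: "(\<lambda>i. v i * t) \<in> V" if "v \<in> V" for v t
      using that by (simp add: V_def mult.assoc [symmetric] sum_distrib_right [symmetric])
    obtain i0 where "i0 \<in> {..<m}" "a i0 \<noteq> 0" using a(1) by blast
    from ex_centralizing_vector[OF finite_lessThan V_diff V_left V_right a_in this]
    obtain w j where w: "w \<in> V" "j \<in> {..<m}" "w j \<noteq> 0" "\<forall>i\<in>{..<m}. w i \<in> center"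
      by blast
    have "w i * b i = b i * 1 * w i" if "i \<in> {..<m}" for i
      using w(4) that centralizerD[of "w i" UNIV "b i"] by simp
    then have "(\<Sum>i<m. w i * b i) = (\<Sum>i<m. b i * 1 * w i)"
      by (rule sum.cong[OF refl])
    also have "\<dots> = 0" using w(1) by (simp only: V_def mem_Collect_eq)
    finally have "(\<Sum>i<m. w i * b i) = 0" .
    moreover have "\<forall>i<m. w i \<in> center" using w(4) by simp
    ultimately have "\<forall>i<m. w i = 0" by (intro b_indep)
    then show False using w(2,3) by simp
  qed
qed

text \<open>A maximal commuting set works: whatever centralizes it could be added to it.\<close>

lemma ex_self_centralizing:
  fixes x :: "'a::ring"
  obtains K where "x \<in> K" "centralizer K = K"
proof -
  define A where "A = {S. x \<in> S \<and> S \<subseteq> centralizer S}"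
  have "\<Union>C \<in> A" if "C \<noteq> {}" "subset.chain A C" for C
  proof -
    have "a * b = b * a" if "a \<in> S" "b \<in> T" "S \<in> C" "T \<in> C" for a b S T
    proof -
      have "S \<subseteq> T \<or> T \<subseteq> S" "S \<in> A" "T \<in> A"
        using \<open>subset.chain A C\<close> that by (auto simp: subset_chain_def)
      then show ?thesis using that by (auto simp: A_def centralizer_def)
    qed
    moreover have "x \<in> \<Union>C"
      using that by (fastforce simp: subset_chain_def A_def)
    ultimately show ?thesis by (auto simp: A_def centralizer_def)
  qed
  moreover have "{x} \<in> A" by (simp add: A_def centralizer_def)
  ultimately obtain K where K: "K \<in> A" "\<forall>S\<in>A. K \<subseteq> S \<longrightarrow> S = K"
    using subset_Zorn_nonempty[of A] by blast
  have "y \<in> K" if "y \<in> centralizer K" for y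
  proof -
    have "insert y K \<in> A"
      using K(1) that by (auto simp: A_def centralizer_def)
    then show ?thesis using K(2) by blast
  qed
  then have "centralizer K = K" "x \<in> K" using K(1) by (auto simp: A_def)
  then show ?thesis using that by blast
qed

section \<open>Linear algebra over subfields of a division ring\<close>

lemma type_algebra_simps [simp]:
  "carrier (ring_of_type_algebra :: 'a::ring_1 ring) = UNIV"
  "monoid.mult (ring_of_type_algebra :: 'a ring) = (*)"
  "add (ring_of_type_algebra :: 'a ring) = (+)"
  "one (ring_of_type_algebra :: 'a ring) = 1"
  "zero (ring_of_type_algebra :: 'a ring) = 0"
  by (auto simp: ring_of_type_algebra_def)

lemma ring_type_algebra: "ring (ring_of_type_algebra :: 'a::ring_1 ring)"
proof -
  have "\<exists>y. x + y = 0" for x :: 'a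
    using add.right_inverse by blast
  then show ?thesis
    unfolding ring_of_type_algebra_def using add.right_inverse
    by unfold_locales (auto simp: algebra_simps Units_def)
qed

text \<open>The lemmas below restate spans, independence and dimensions of the division ring, viewed as a
  ring record with carrier \<open>UNIV\<close>, in terms of sums over the type.\<close>

interpretation D: ring "ring_of_type_algebra :: 'a::division_ring ring"
  by (rule ring_type_algebra)

declare D.Span.simps [simp del]

lemma sum_in_closed:
  assumes "0 \<in> E" "\<And>a b. a \<in> E \<Longrightarrow> b \<in> E \<Longrightarrow> a + b \<in> E" "\<And>i. i \<in> I \<Longrightarrow> f i \<in> E"
  shows "sum f I \<in> E"
  using assms(3) by (induction I rule: infinite_finite_induct) (auto intro: assms(1,2))

lemma D_a_inv [simp]: "\<ominus>\<^bsub>ring_of_type_algebra\<^esub> x = - (x::'a::division_ring)"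
  by (rule D.minus_equality) auto

lemma D_pow [simp]: "x [^]\<^bsub>ring_of_type_algebra\<^esub> (n::nat) = (x::'a::division_ring) ^ n"
  by (induction n) (simp_all add: power_commutes)

lemma ring_center_type_algebra: "ring_center ring_of_type_algebra = (center :: 'a::division_ring set)"
  by (simp add: ring_center_def centralizer_def)

lemma D_subfieldI:
  fixes K :: "'a::division_ring set"
  assumes "1 \<in> K" "\<And>a. a \<in> K \<Longrightarrow> - a \<in> K" "\<And>a b. a \<in> K \<Longrightarrow> b \<in> K \<Longrightarrow> a + b \<in> K"
    "\<And>a b. a \<in> K \<Longrightarrow> b \<in> K \<Longrightarrow> a * b \<in> K" "\<And>a. a \<in> K \<Longrightarrow> a \<noteq> 0 \<Longrightarrow> inverse a \<in> K"
    "\<And>a b. a \<in> K \<Longrightarrow> b \<in> K \<Longrightarrow> a * b = b * a"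
  shows "subfield K ring_of_type_algebra"
proof (rule D.subfieldI)
  show "subcring K ring_of_type_algebra"
    by (intro D.subcringI D.subringI) (use assms in auto)
  have "0 \<in> K" using assms(1,2,3) by (metis add.right_inverse)
  have "a \<in> Units (ring_of_type_algebra\<lparr>carrier := K\<rparr>) \<longleftrightarrow> a \<in> K - {0}" for a
  proof
    assume "a \<in> K - {0}"
    then show "a \<in> Units (ring_of_type_algebra\<lparr>carrier := K\<rparr>)"
      using assms(5) by (auto simp: Units_def intro!: bexI[of _ "inverse a"])
  qed (auto simp: Units_def)
  then show "Units (ring_of_type_algebra\<lparr>carrier := K\<rparr>) = K - {\<zero>\<^bsub>ring_of_type_algebra\<^esub>}"
    by auto
qed

text \<open>Used for the center (\<open>S = UNIV\<close>) and for a self-centralizing set (\<open>S = K\<close>).\<close>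

lemma D_subfield_centralizer:
  fixes K :: "'a::division_ring set"
  assumes "centralizer S = K" "K \<subseteq> S"
  shows "subfield K ring_of_type_algebra"
  unfolding assms(1) [symmetric]
  by (rule D_subfieldI)
    (use assms in \<open>auto intro: centralizer_one centralizer_uminus centralizer_add centralizer_mult
      centralizer_inverse centralizerD\<close>)

lemma D_combine_eq_sum:
  fixes Ks Us :: "'a::division_ring list"
  shows "length Ks = length Us \<Longrightarrow> D.combine Ks Us = (\<Sum>i<length Us. Ks ! i * Us ! i)"
proof (induction Ks Us rule: list_induct2)
  case (Cons k Ks u Us)
  then show ?case
    by (simp add: sum.lessThan_Suc_shift del: sum.lessThan_Suc)
qed simp

lemma D_Span_iff:
  fixes K :: "'a::division_ring set"
  assumes "subfield K ring_of_type_algebra"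
  shows "y \<in> D.Span K Us \<longleftrightarrow>
    (\<exists>c. (\<forall>i<length Us. c i \<in> K) \<and> y = (\<Sum>i<length Us. c i * Us ! i))"
proof -
  have "y \<in> D.Span K Us \<longleftrightarrow> (\<exists>Ks. set Ks \<subseteq> K \<and> length Ks = length Us \<and> y = D.combine Ks Us)"
    by (rule D.Span_mem_iff_length_version[OF assms]) simp
  also have "\<dots> \<longleftrightarrow> (\<exists>c. (\<forall>i<length Us. c i \<in> K) \<and> y = (\<Sum>i<length Us. c i * Us ! i))"
  proof (intro iffI; elim exE conjE)
    fix Ks assume "set Ks \<subseteq> K" "length Ks = length Us" "y = D.combine Ks Us"
    then show "\<exists>c. (\<forall>i<length Us. c i \<in> K) \<and> y = (\<Sum>i<length Us. c i * Us ! i)"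
      by (intro exI[of _ "(!) Ks"]) (auto simp: D_combine_eq_sum)
  next
    fix c assume c: "\<forall>i<length Us. c i \<in> K" "y = (\<Sum>i<length Us. c i * Us ! i)"
    then have "y = D.combine (map c [0..<length Us]) Us"
      by (simp add: D_combine_eq_sum)
    then show "\<exists>Ks. set Ks \<subseteq> K \<and> length Ks = length Us \<and> y = D.combine Ks Us"
      using c(1) by (intro exI[of _ "map c [0..<length Us]"]) auto
  qed
  finally show ?thesis .
qed

lemma D_independent_iff:
  fixes K :: "'a::division_ring set"
  assumes "subfield K ring_of_type_algebra"
  shows "D.independent K Us \<longleftrightarrow>
    (\<forall>c. (\<forall>i<length Us. c i \<in> K) \<longrightarrow> (\<Sum>i<length Us. c i * Us ! i) = 0 \<longrightarrow>
      (\<forall>i<length Us. c i = 0))"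
    (is "?L \<longleftrightarrow> ?R")
proof
  assume L: ?L
  show ?R
  proof (intro allI impI)
    fix c i assume c: "\<forall>i<length Us. c i \<in> K" "(\<Sum>i<length Us. c i * Us ! i) = 0" "i < length Us"
    have "set (take (length Us) (map c [0..<length Us])) \<subseteq> {\<zero>\<^bsub>ring_of_type_algebra\<^esub>}"
      by (rule D.independent_imp_trivial_combine[OF assms L])
        (use c in \<open>auto simp: D_combine_eq_sum\<close>)
    then show "c i = 0" using c(3) by (auto simp: image_subset_iff)
  qed
next
  assume R: ?R
  show ?L
  proof (rule D.trivial_combine_imp_independent[OF assms])
    fix Ks assume Ks: "set Ks \<subseteq> K" "D.combine Ks Us = \<zero>\<^bsub>ring_of_type_algebra\<^esub>"
    define c where "c = (\<lambda>i. if i < length Ks then Ks ! i else 0)"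
    have "0 \<in> K" using subringE(2)[OF subfieldE(1)[OF assms]] by simp
    then have cK: "\<forall>i<length Us. c i \<in> K" using Ks(1) by (auto simp: c_def)
    have comb: "D.combine Ks Us = (\<Sum>i<length Us. c i * Us ! i)"
      unfolding c_def
    proof (induction Us arbitrary: Ks)
      case (Cons u Us)
      then show ?case
        by (cases Ks)
          (auto simp: sum.lessThan_Suc_shift simp del: sum.lessThan_Suc intro!: sum.cong)
    qed simp
    then have "\<forall>i<length Us. c i = 0" using R cK Ks(2) by simp
    moreover have "Ks ! i = c i" if "i < length Ks" for i using that by (simp add: c_def)
    ultimately show "set (take (length Us) Ks) \<subseteq> {\<zero>\<^bsub>ring_of_type_algebra\<^esub>}"
      by (auto simp: in_set_conv_nth)
  qed simp
qed

lemma D_dimensionE: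
  fixes K E :: "'a::division_ring set"
  assumes "subfield K ring_of_type_algebra" "D.dimension n K E"
  obtains b where "left_basis K E n b"
proof -
  obtain Vs where Vs: "D.independent K Vs" "length Vs = n" "D.Span K Vs = E"
    using D.exists_base[OF assms] by blast
  have "set Vs \<subseteq> E" using D.Span_base_incl[OF assms(1), of Vs] Vs(3) by simp
  have "left_basis K E n ((!) Vs)"
    unfolding left_basis_def
  proof (intro conjI allI impI ballI)
    show "Vs ! i \<in> E" if "i < n" for i
      using \<open>set Vs \<subseteq> E\<close> Vs(2) that by auto
    show "\<exists>c. (\<forall>i<n. c i \<in> K) \<and> y = (\<Sum>i<n. c i * Vs ! i)" if "y \<in> E" for y
      using that D_Span_iff[OF assms(1), of y Vs] Vs(2,3) by simp
    show "c i = 0" if "\<forall>i<n. c i \<in> K" "(\<Sum>i<n. c i * Vs ! i) = 0" "i < n" for c i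
      using that D_independent_iff[OF assms(1), of Vs] Vs(1,2) by simp
  qed
  then show ?thesis by (rule that)
qed

lemma D_dimensionI:
  fixes K E :: "'a::division_ring set" and b :: "nat \<Rightarrow> 'a"
  assumes "subfield K ring_of_type_algebra"
    and indep: "\<And>c. (\<forall>i<n. c i \<in> K) \<Longrightarrow> (\<Sum>i<n. c i * b i) = 0 \<Longrightarrow> \<forall>i<n. c i = 0"
  shows "D.dimension n K {\<Sum>i<n. c i * b i | c. \<forall>i<n. c i \<in> K}"
proof -
  let ?Us = "map b [0..<n]"
  have "D.independent K ?Us"
    using indep by (simp add: D_independent_iff[OF assms(1)])
  moreover have "D.Span K ?Us = {\<Sum>i<n. c i * b i | c. \<forall>i<n. c i \<in> K}"
    unfolding set_eq_iff by (simp add: D_Span_iff[OF assms(1)]) blast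
  ultimately show ?thesis
    using D.dimensionI[OF assms(1), of ?Us] by simp
qed

lemma center_subfield: "subfield (center :: 'a::division_ring set) ring_of_type_algebra"
  by (rule D_subfield_centralizer[OF refl]) simp

lemma powers_independent_le_dim:
  fixes x :: "'a::division_ring"
  assumes "D.dimension N center (UNIV :: 'a set)" "powers_independent x m"
  shows "m \<le> N"
proof -
  have "D.independent center (map ((^) x) [0..<m])"
    using assms(2) by (simp add: D_independent_iff[OF center_subfield] powers_independent_def)
  from D.independent_length_le_dimension[OF center_subfield assms(1) this] show ?thesis by simp
qed

section \<open>Simple extensions of the center\<close>

text \<open>The simple extension \<open>F(x)\<close> of the center \<open>F\<close>, when \<open>m\<close> is the degree of \<open>x\<close>.\<close>

definition power_span :: "'a::division_ring \<Rightarrow> nat \<Rightarrow> 'a set" where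
  "power_span x m = {\<Sum>i<m. c i * x ^ i | c. \<forall>i<m. c i \<in> center}"

lemma power_span_add:
  assumes "a \<in> power_span x m" "b \<in> power_span x m"
  shows "a + b \<in> power_span x m"
proof -
  obtain c d where "\<forall>i<m. c i \<in> center" "a = (\<Sum>i<m. c i * x ^ i)"
    "\<forall>i<m. d i \<in> center" "b = (\<Sum>i<m. d i * x ^ i)"
    using assms by (auto simp: power_span_def)
  then show ?thesis
    unfolding power_span_def
    by (intro CollectI exI[of _ "\<lambda>i. c i + d i"])
      (auto simp: distrib_right sum.distrib intro: centralizer_add)
qed

lemma power_span_central_mult:
  assumes "z \<in> center" "a \<in> power_span x m"
  shows "z * a \<in> power_span x m"
proof -
  obtain c where "\<forall>i<m. c i \<in> center" "a = (\<Sum>i<m. c i * x ^ i)"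
    using assms by (auto simp: power_span_def)
  then show ?thesis
    unfolding power_span_def
    by (intro CollectI exI[of _ "\<lambda>i. z * c i"])
      (auto simp: sum_distrib_left mult.assoc intro: centralizer_mult assms(1))
qed

lemma power_in_power_span:
  assumes "i < m"
  shows "x ^ i \<in> power_span x m"
proof -
  have "x ^ i = (\<Sum>j<m. (if j = i then 1 else 0) * x ^ j)"
    using assms by (simp add: if_distrib [of "\<lambda>c. c * _"] cong: if_cong)
  then show ?thesis
    unfolding power_span_def
    by (intro CollectI exI[of _ "\<lambda>j. if j = i then 1 else 0"])
      (auto intro: centralizer_zero centralizer_one)
qed

lemma power_span_sum:
  assumes "\<And>i. i \<in> I \<Longrightarrow> a i \<in> power_span x m"
  shows "(\<Sum>i\<in>I. a i) \<in> power_span x m"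
proof -
  have "0 \<in> power_span x m"
    unfolding power_span_def
    by (intro CollectI exI[of _ "\<lambda>_. 0"]) (auto intro: centralizer_zero)
  then show ?thesis by (rule sum_in_closed) (auto intro: power_span_add assms)
qed

lemma power_span_mult:
  fixes x :: "'a::division_ring"
  assumes f: "minimal_relation x m f"
    and "a \<in> power_span x m" "b \<in> power_span x m"
  shows "a * b \<in> power_span x m"
proof -
  obtain k where k: "m = Suc k"
    using minimal_relation_degree_pos[OF f] by (cases m) auto
  have top: "x ^ m \<in> power_span x m"
  proof -
    have "(\<Sum>i<m. f i * x ^ i) + x ^ m = 0"
      using f by (auto simp: minimal_relation_def lessThan_Suc_atMost [symmetric])
    then have "x ^ m = (\<Sum>i<m. (- f i) * x ^ i)"
      by (simp add: sum_negf eq_neg_iff_add_eq_0 add.commute)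
    then show ?thesis
      using f unfolding power_span_def minimal_relation_def
      by (intro CollectI exI[of _ "\<lambda>i. - f i"]) (auto intro: centralizer_uminus)
  qed
  have step: "x * d \<in> power_span x m" if "d \<in> power_span x m" for d
  proof -
    obtain c where c: "\<forall>i<m. c i \<in> center" "d = (\<Sum>i<m. c i * x ^ i)"
      using \<open>d \<in> power_span x m\<close> by (auto simp: power_span_def)
    have "x * (c i * x ^ i) = c i * x ^ Suc i" if "i < m" for i
      using c(1) that centralizerD[of "c i" UNIV x] by (simp add: mult.assoc [symmetric])
    then have "x * d = (\<Sum>i<m. c i * x ^ Suc i)"
      unfolding c(2) sum_distrib_left by (intro sum.cong) auto
    also have "\<dots> \<in> power_span x m"
    proof (intro power_span_sum power_span_central_mult)
      fix i assume "i \<in> {..<m}"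
      then show "x ^ Suc i \<in> power_span x m" "c i \<in> center"
        using top power_in_power_span[of "Suc i" m x] c(1)
        by (cases "Suc i = m"; simp)+
    qed
    finally show ?thesis .
  qed
  have pow: "x ^ i * b \<in> power_span x m" for i
  proof (induction i)
    case (Suc i)
    then show ?case using step[of "x ^ i * b"] by (simp add: mult.assoc)
  qed (use assms(3) in simp)
  obtain c where c: "\<forall>i<m. c i \<in> center" "a = (\<Sum>i<m. c i * x ^ i)"
    using assms(2) by (auto simp: power_span_def)
  have "a * b = (\<Sum>i<m. c i * (x ^ i * b))"
    by (simp add: c(2) sum_distrib_right mult.assoc)
  also have "\<dots> \<in> power_span x m"
    by (intro power_span_sum power_span_central_mult pow) (use c(1) in auto)
  finally show ?thesis .
qed

text \<open>For inverses: multiplication by \<open>a \<noteq> 0\<close> carries the basis of powers to \<open>m\<close> independent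
  elements of the \<open>m\<close>-dimensional space \<open>F(x)\<close>, so \<open>1\<close> is a multiple of \<open>a\<close> there.  For
  commutativity: any centralizer that contains \<open>x\<close> contains \<open>F(x)\<close>, which
  is applied twice.\<close>

lemma power_span_subfield:
  fixes x :: "'a::division_ring"
  assumes f: "minimal_relation x m f"
  shows "subfield (power_span x m) ring_of_type_algebra"
proof (rule D_subfieldI)
  have indep: "powers_independent x m" using f by (simp add: minimal_relation_def)
  have dim: "D.dimension m center (power_span x m)"
    unfolding power_span_def
    by (rule D_dimensionI[OF center_subfield]) (use indep in \<open>auto simp: powers_independent_def\<close>)
  show one: "1 \<in> power_span x m"
    using power_in_power_span[of 0 m x] minimal_relation_degree_pos[OF f] by simp
  show "- a \<in> power_span x m" if "a \<in> power_span x m" for a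
    using power_span_central_mult[OF centralizer_uminus[OF centralizer_one] that] by simp
  show "a * b = b * a" if ab: "a \<in> power_span x m" "b \<in> power_span x m" for a b
  proof -
    have x: "x \<in> centralizer {x}" by (simp add: centralizer_def)
    have pow: "x ^ i \<in> centralizer S" if "x \<in> centralizer S" for i S
      by (induction i) (auto intro: centralizer_one centralizer_mult that)
    have span: "d \<in> centralizer S" if "d \<in> power_span x m" "x \<in> centralizer S" for d S
    proof -
      obtain c where c: "\<forall>i<m. c i \<in> center" "d = (\<Sum>i<m. c i * x ^ i)"
        using \<open>d \<in> power_span x m\<close> by (auto simp: power_span_def)
      have "c i * x ^ i \<in> centralizer S" if "i \<in> {..<m}" for i
        using c(1) that center_subset_centralizer[of S] pow[OF \<open>x \<in> centralizer S\<close>, of i]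
        by (auto intro!: centralizer_mult)
      then show ?thesis
        unfolding c(2) by (intro sum_in_closed centralizer_zero centralizer_add)
    qed
    have "x \<in> centralizer {b}"
      using span[OF ab(2) x] by (simp add: centralizer_def)
    from span[OF ab(1) this] show ?thesis by (simp add: centralizer_def)
  qed
  show "inverse a \<in> power_span x m" if a: "a \<in> power_span x m" "a \<noteq> 0" for a
  proof -
    let ?Us = "map (\<lambda>i. a * x ^ i) [0..<m]"
    have shift: "(\<Sum>i<m. c i * (a * x ^ i)) = a * (\<Sum>i<m. c i * x ^ i)"
      if "\<forall>i<m. c i \<in> center" for c
    proof -
      have "c i * (a * x ^ i) = a * (c i * x ^ i)" if "i < m" for i
        using centralizerD[of "c i" UNIV a] that \<open>\<forall>i<m. c i \<in> center\<close>
        by (simp add: mult.assoc [symmetric])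
      then show ?thesis by (simp add: sum_distrib_left)
    qed
    have Us_indep: "D.independent center ?Us"
      using indep shift a(2) by (auto simp: D_independent_iff[OF center_subfield] powers_independent_def)
    have "set ?Us \<subseteq> power_span x m"
      using power_span_mult[OF f a(1) power_in_power_span] by auto
    from D.independent_length_eq_dimension[OF center_subfield dim Us_indep this]
    have "1 \<in> D.Span center ?Us"
      using one by simp
    then obtain c where c: "\<forall>i<m. c i \<in> center" "1 = (\<Sum>i<m. c i * (a * x ^ i))"
      unfolding D_Span_iff[OF center_subfield] by auto
    then have "a * (\<Sum>i<m. c i * x ^ i) = 1" using shift by simp
    then have "inverse a = (\<Sum>i<m. c i * x ^ i)"
      by (rule inverse_unique)
    then show ?thesis using c(1) by (auto simp: power_span_def)
  qed
qed (use power_span_add power_span_mult[OF f] in auto)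

section \<open>The degree of an element and the dimension\<close>

lemma D_finite_dimension_mono:
  fixes K L :: "'a::division_ring set"
  assumes "subfield K ring_of_type_algebra" "subfield L ring_of_type_algebra" "K \<subseteq> L"
    and "D.finite_dimension K E" "\<And>k v. k \<in> L \<Longrightarrow> v \<in> E \<Longrightarrow> k * v \<in> E"
  shows "D.finite_dimension L E"
proof -
  obtain n where n: "D.dimension n K E" using assms(4) by auto
  obtain Vs where Vs: "D.independent K Vs" "length Vs = n" "D.Span K Vs = E"
    using D.exists_base[OF assms(1) n] by blast
  have "set Vs \<subseteq> E" using D.Span_base_incl[OF assms(1), of Vs] Vs(3) by simp
  have "D.Span L Vs = E"
  proof (intro equalityI subsetI)
    fix y assume "y \<in> E"
    then show "y \<in> D.Span L Vs"
      using assms(3) unfolding Vs(3) [symmetric] D_Span_iff[OF assms(1)] D_Span_iff[OF assms(2)] by blast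
  next
    fix y assume "y \<in> D.Span L Vs"
    then obtain c where c: "\<forall>i<n. c i \<in> L" "y = (\<Sum>i<n. c i * Vs ! i)"
      using Vs(2) by (auto simp: D_Span_iff[OF assms(2)])
    have E: "0 \<in> E" "\<And>a b. a \<in> E \<Longrightarrow> b \<in> E \<Longrightarrow> a + b \<in> E"
      using D.space_subgroup_props(2,3)[OF assms(1) n] by auto
    show "y \<in> E"
      unfolding c(2)
      by (rule sum_in_closed[OF E]) (use c(1) Vs(2) \<open>set Vs \<subseteq> E\<close> in \<open>auto intro!: assms(5)\<close>)
  qed
  then show ?thesis
    using D.Span_finite_dimension[OF assms(2), of Vs] by simp
qed

text \<open>Put a self-centralizing \<open>K\<close> around \<open>x\<close>, so \<open>F \<subseteq> F(x) \<subseteq> K \<subseteq> D\<close>.  Then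
  \<open>dim\<^sub>F D = (dim\<^sub>F K)(dim\<^sub>K D) = (dim\<^sub>F K)\<^sup>2\<close>, and \<open>dim\<^sub>F K\<close> is a multiple of
  \<open>dim\<^sub>F F(x)\<close>, the degree of \<open>x\<close>.\<close>

lemma degree_dvd_sqrt_dim:
  fixes x :: "'a::division_ring"
  assumes "D.finite_dimension center (UNIV :: 'a set)"
  obtains m f where "minimal_relation x m f" "m dvd floor_sqrt (D.dim center (UNIV :: 'a set))"
proof -
  obtain N where N: "D.dimension N center (UNIV :: 'a set)" using assms by auto
  then have "D.dim center (UNIV :: 'a set) = N"
    using D.dimI[OF center_subfield] by (simp add: over_def)
  have "\<not> powers_independent x (Suc N)"
    using powers_independent_le_dim[OF N, of x "Suc N"] by auto
  then obtain m f where f: "minimal_relation x m f" by (rule ex_minimal_relation)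
  let ?L = "power_span x m"
  obtain K where K: "x \<in> K" "centralizer K = K" by (rule ex_self_centralizing)
  have subK: "subfield K ring_of_type_algebra"
    using D_subfield_centralizer[OF K(2)] by simp
  have subL: "subfield ?L ring_of_type_algebra"
    by (rule power_span_subfield[OF f])
  have center_K: "center \<subseteq> K"
    using center_subset_centralizer[of K] K(2) by simp
  have K_add: "a + b \<in> K" and K_mult: "a * b \<in> K" if "a \<in> K" "b \<in> K" for a b
    using that centralizer_add[of a K b] centralizer_mult[of a K b] K(2) by auto
  have one_K: "1 \<in> K" using centralizer_one[of K] K(2) by simp
  have LK: "?L \<subseteq> K"
  proof
    fix d assume "d \<in> ?L"
    then obtain c where c: "\<forall>i<m. c i \<in> center" "d = (\<Sum>i<m. c i * x ^ i)"
      by (auto simp: power_span_def)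
    have pow: "x ^ i \<in> K" for i
      by (induction i) (auto intro: one_K K_mult K(1))
    show "d \<in> K"
      unfolding c(2)
    proof (rule sum_in_closed)
      show "0 \<in> K" using centralizer_zero[of K] K(2) by simp
      show "c i * x ^ i \<in> K" if "i \<in> {..<m}" for i
        using c(1) center_K that by (intro K_mult pow) auto
    qed (rule K_add)
  qed
  have center_L: "center \<subseteq> ?L"
  proof
    fix z :: 'a assume "z \<in> center"
    then have "z * x ^ 0 \<in> ?L"
      using power_span_central_mult power_in_power_span minimal_relation_degree_pos[OF f] by blast
    then show "z \<in> ?L" by simp
  qed
  have fin_K: "D.finite_dimension center K"
  proof (rule D.subalbegra_incl_imp_finite_dimension[OF center_subfield assms])
    show "subalgebra center K ring_of_type_algebra"
    proof (intro subalgebra.intro subalgebra_axioms.intro)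
      show "subgroup K (add_monoid ring_of_type_algebra)"
        using subring.axioms(1)[OF subfieldE(1)[OF subK]] .
    qed (use center_K K_mult in auto)
  qed simp
  then obtain r where r: "D.dimension r center K" by auto
  have "D.finite_dimension K (UNIV :: 'a set)"
    by (rule D_finite_dimension_mono[OF center_subfield subK center_K assms]) simp
  then obtain s where s: "D.dimension s K (UNIV :: 'a set)" by auto
  have "D.finite_dimension ?L K"
    by (rule D_finite_dimension_mono[OF center_subfield subL center_L fin_K])
      (use LK K_mult in auto)
  then obtain t where t: "D.dimension t ?L K" by auto
  have "D.dimension m center ?L"
    unfolding power_span_def
    by (rule D_dimensionI[OF center_subfield])
      (use f in \<open>auto simp: powers_independent_def minimal_relation_def\<close>)
  from D.telescopic_base[OF center_subfield subL this t] have "r = m * t"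
    using D.dimension_is_inj[OF center_subfield r] by simp
  moreover have "N = r * s"
    using D.dimension_is_inj[OF center_subfield N D.telescopic_base[OF center_subfield subK r s]] .
  moreover have "s = r"
  proof -
    obtain b where "left_basis center K r b" by (rule D_dimensionE[OF center_subfield r])
    moreover obtain e where "left_basis K UNIV s e" by (rule D_dimensionE[OF subK s])
    ultimately show ?thesis by (rule self_centralizing_left_dim_eq[OF K(2)])
  qed
  ultimately have "floor_sqrt N = m * t" by (simp add: power2_eq_square [symmetric])
  then show ?thesis
    using that[OF f] \<open>D.dim center UNIV = N\<close> by simp
qed

lemma algebraic_imp_minimal_relation:
  fixes x :: "'a::division_ring"
  assumes "algebraic_over_center (ring_of_type_algebra :: 'a ring)"
  obtains m f where "minimal_relation x m f"
proof -
  obtain p where p: "p \<in> carrier (univ_poly ring_of_type_algebra (center :: 'a set))" "p \<noteq> []"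
    "D.eval p x = 0"
    using assms by (auto simp: algebraic_over_center_def ring_center_type_algebra)
  then have p': "set p \<subseteq> center" "hd p \<noteq> 0"
    by (auto simp: univ_poly_carrier [symmetric] polynomial_def)
  \<comment> \<open>Coefficient lists start with the leading coefficient.\<close>
  define c where "c = (\<lambda>i. rev p ! i)"
  have "D.eval q x = (\<Sum>i<length q. rev q ! i * x ^ i)" for q
    by (induction q) (simp_all add: nth_append)
  then have "(\<Sum>i<length p. c i * x ^ i) = 0" using p(3) by (simp add: c_def)
  moreover have "c i \<in> center" if "i < length p" for i
    using p'(1) that nth_mem[of i "rev p"] by (auto simp: c_def)
  moreover have "c (length p - 1) \<noteq> 0" "length p - 1 < length p"
    using p(2) p'(2) by (auto simp: c_def rev_nth hd_conv_nth)
  ultimately have "\<not> powers_independent x (length p)"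
    unfolding powers_independent_def by blast
  then show ?thesis using that by (rule ex_minimal_relation)
qed

section \<open>Matrices modulo commutators\<close>

lemma ring_ring_mat: "ring (ring_mat TYPE('a::ring_1) n b)"
proof -
  interpret semiring "ring_mat TYPE('a) n b" by (rule semiring_mat)
  have inv: "\<exists>B\<in>carrier_mat n n. B + A = 0\<^sub>m n n \<and> A + B = 0\<^sub>m n n" if "A \<in> carrier_mat n n"
    for A :: "'a mat"
    using that by (intro bexI[of _ "- A"]) (auto intro!: eq_matI)
  show ?thesis
    by unfold_locales
      (use inv in \<open>auto simp: ring_mat_def Units_def add_mult_distrib_mat mult_add_distrib_mat\<close>)
qed

context
  fixes n :: nat
begin

interpretation M: ring "ring_mat TYPE('a::ring_1) n ()"
  by (rule ring_ring_mat)

lemma mat_minus_eq: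
  fixes A B :: "'a::ring_1 mat"
  assumes "A \<in> carrier_mat n n" "B \<in> carrier_mat n n"
  shows "A \<ominus>\<^bsub>ring_mat TYPE('a) n ()\<^esub> B = A - B"
proof -
  have "\<ominus>\<^bsub>ring_mat TYPE('a) n ()\<^esub> B = - B"
    by (rule M.minus_equality) (use assms in \<open>auto simp: ring_mat_simps intro!: eq_matI\<close>)
  then show ?thesis
    using assms by (auto simp: a_minus_def ring_mat_simps intro!: eq_matI)
qed

lemma mat_commutator_in_subgroup:
  fixes A B :: "'a::ring_1 mat"
  assumes "A \<in> carrier_mat n n" "B \<in> carrier_mat n n"
  shows "A * B - B * A \<in> commutator_subgroup (ring_mat TYPE('a) n ())"
  unfolding commutator_subgroup_def
proof (rule generate.incl)
  have "A * B \<in> carrier_mat n n" "B * A \<in> carrier_mat n n" using assms by auto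
  note diff = mat_minus_eq[OF this]
  show "A * B - B * A \<in> additive_commutators (ring_mat TYPE('a) n ())"
    unfolding additive_commutators_def mem_Collect_eq
    by (rule exI[of _ A], rule exI[of _ B]) (simp add: ring_mat_simps diff assms)
qed

lemma mat_commutator_subgroup_zero:
  "0\<^sub>m n n \<in> commutator_subgroup (ring_mat TYPE('a::ring_1) n ())"
  using generate.one[of "add_monoid (ring_mat TYPE('a) n ())"]
  by (simp add: commutator_subgroup_def ring_mat_simps)

lemma mat_commutator_subgroup_add:
  assumes "A \<in> commutator_subgroup (ring_mat TYPE('a::ring_1) n ())"
    "B \<in> commutator_subgroup (ring_mat TYPE('a) n ())"
  shows "A + B \<in> commutator_subgroup (ring_mat TYPE('a) n ())"
  using generate.eng[OF assms [unfolded commutator_subgroup_def]]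
  by (simp add: commutator_subgroup_def ring_mat_simps)

lemma mat_commutator_subgroup_subset:
  "commutator_subgroup (ring_mat TYPE('a::ring_1) n ()) \<subseteq> carrier_mat n n"
proof -
  have "additive_commutators (ring_mat TYPE('a) n ()) \<subseteq> carrier (ring_mat TYPE('a) n ())"
    unfolding additive_commutators_def by (auto intro!: M.minus_closed M.m_closed)
  from M.add.generate_incl[OF this] show ?thesis
    by (simp add: commutator_subgroup_def ring_mat_simps)
qed

end

definition unit_mat :: "nat \<Rightarrow> nat \<Rightarrow> nat \<Rightarrow> 'a::ring_1 \<Rightarrow> 'a mat" where
  "unit_mat n i j a = mat n n (\<lambda>(k, l). if k = i \<and> l = j then a else 0)"

lemma unit_mat_carrier [simp]: "unit_mat n i j a \<in> carrier_mat n n"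
  by (simp add: unit_mat_def)

lemma unit_mat_index [simp]:
  "k < n \<Longrightarrow> l < n \<Longrightarrow> unit_mat n i j a $$ (k, l) = (if k = i \<and> l = j then a else 0)"
  "dim_row (unit_mat n i j a) = n" "dim_col (unit_mat n i j a) = n"
  by (auto simp: unit_mat_def)

lemma unit_mat_mult:
  assumes "j < n"
  shows "unit_mat n i j a * unit_mat n k l b = (if j = k then unit_mat n i l (a * b) else 0\<^sub>m n n)"
proof (rule eq_matI)
  fix r c assume "r < dim_row (if j = k then unit_mat n i l (a * b) else 0\<^sub>m n n)"
    "c < dim_col (if j = k then unit_mat n i l (a * b) else 0\<^sub>m n n)"
  then have rc: "r < n" "c < n" by (auto split: if_splits)
  have "(unit_mat n i j a * unit_mat n k l b) $$ (r, c) =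
      (\<Sum>s\<in>{0..<n}. unit_mat n i j a $$ (r, s) * unit_mat n k l b $$ (s, c))"
    using rc by (simp add: scalar_prod_def)
  also have "\<dots> = (\<Sum>s\<in>{0..<n}. if s = j then
      (if r = i \<and> j = k \<and> c = l then a * b else 0) else 0)"
    using rc by (intro sum.cong) auto
  also have "\<dots> = (if j = k then unit_mat n i l (a * b) else 0\<^sub>m n n) $$ (r, c)"
    using rc assms by simp
  finally show "(unit_mat n i j a * unit_mat n k l b) $$ (r, c) =
    (if j = k then unit_mat n i l (a * b) else 0\<^sub>m n n) $$ (r, c)" .
qed (auto split: if_splits)

lemma unit_mat_offdiag_in_commutators:
  fixes a :: "'a::ring_1"
  assumes "i < n" "j < n" "i \<noteq> j"
  shows "unit_mat n i j a \<in> commutator_subgroup (ring_mat TYPE('a) n ())"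
proof -
  have "unit_mat n i i a * unit_mat n i j 1 - unit_mat n i j 1 * unit_mat n i i a = unit_mat n i j a"
    using assms by (auto simp: unit_mat_mult intro!: eq_matI)
  then show ?thesis
    using mat_commutator_in_subgroup[of "unit_mat n i i a" n "unit_mat n i j 1"] by simp
qed

lemma unit_mat_diag_diff_in_commutators:
  fixes a :: "'a::ring_1"
  assumes "i < n" "j < n"
  shows "unit_mat n i i a - unit_mat n j j a \<in> commutator_subgroup (ring_mat TYPE('a) n ())"
  using mat_commutator_in_subgroup[of "unit_mat n i j a" n "unit_mat n j i 1"] assms
  by (simp add: unit_mat_mult)

lemma unit_mat_commutator_span:
  fixes k :: "'a::ring_1"
  assumes "i < n" "k \<in> commutator_span"
  shows "unit_mat n i i k \<in> commutator_subgroup (ring_mat TYPE('a) n ())"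
  using assms(2)
proof (induction k)
  case zero
  have "unit_mat n i i (0::'a) = 0\<^sub>m n n" by (auto intro!: eq_matI)
  then show ?case by (simp add: mat_commutator_subgroup_zero)
next
  case (add_commutator k a b)
  have "unit_mat n i i (k + (a * b - b * a)) = unit_mat n i i k +
      (unit_mat n i i a * unit_mat n i i b - unit_mat n i i b * unit_mat n i i a)"
    using assms(1) by (auto simp: unit_mat_mult intro!: eq_matI)
  then show ?case
    using mat_commutator_subgroup_add[OF add_commutator.IH
        mat_commutator_in_subgroup[of "unit_mat n i i a" n "unit_mat n i i b"]]
    by simp
qed

text \<open>Modulo commutators, off-diagonal entries can be dropped and all diagonal entries can be moved to
  position \<open>(0, 0)\<close>.  Hence a matrix is congruent to its trace at that position, which is a
  sum of commutators of multiples of one matrix unit when the trace is a sum of commutators.\<close>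

lemma mat_trace_in_commutators:
  fixes A :: "'a::ring_1 mat"
  assumes A: "A \<in> carrier_mat n n" and "(\<Sum>i<n. A $$ (i, i)) \<in> commutator_span" and "n > 0"
  shows "A \<in> commutator_subgroup (ring_mat TYPE('a) n ())"
proof -
  let ?G = "commutator_subgroup (ring_mat TYPE('a) n ())"
  \<comment> \<open>The part of the matrix supported on S, minus the trace of that part at (0, 0);
    entries are added to S one at a time.\<close>
  define t where "t = (\<lambda>S. \<Sum>i | i < n \<and> (i, i) \<in> S. A $$ (i, i))"
  define R where "R = (\<lambda>S. mat n n (\<lambda>(k, l). (if (k, l) \<in> S then A $$ (k, l) else 0) -
    (if k = 0 \<and> l = 0 then t S else 0)))"
  have R_in: "R S \<in> ?G" if "finite S" "S \<subseteq> {..<n} \<times> {..<n}" for S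
    using that
  proof (induction S)
    case empty
    have "R {} = 0\<^sub>m n n" by (auto simp: R_def t_def intro!: eq_matI)
    then show ?case by (simp add: mat_commutator_subgroup_zero)
  next
    case (insert p S)
    obtain i j where p: "p = (i, j)" by (cases p)
    with insert.prems insert.hyps have ij: "i < n" "j < n" "(i, j) \<notin> S" by auto
    have IH: "R S \<in> ?G" using insert by simp
    show ?case
    proof (cases "i = j")
      case True
      have "{k. k < n \<and> (k, k) \<in> insert p S} = insert i {k. k < n \<and> (k, k) \<in> S}"
        using p ij True by auto
      then have "t (insert p S) = A $$ (i, i) + t S"
        using ij True by (simp add: t_def)
      then have "R (insert p S) = R S + (unit_mat n i i (A $$ (i, i)) - unit_mat n 0 0 (A $$ (i, i)))"
        using ij True by (intro eq_matI) (auto simp: R_def p)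
      then show ?thesis
        using mat_commutator_subgroup_add[OF IH unit_mat_diag_diff_in_commutators] ij(1) assms(3)
        by simp
    next
      case False
      have "{k. k < n \<and> (k, k) \<in> insert p S} = {k. k < n \<and> (k, k) \<in> S}"
        using p False by auto
      then have "t (insert p S) = t S"
        by (simp add: t_def)
      then have "R (insert p S) = R S + unit_mat n i j (A $$ (i, j))"
        using ij False by (intro eq_matI) (auto simp: R_def p)
      then show ?thesis
        using mat_commutator_subgroup_add[OF IH unit_mat_offdiag_in_commutators] ij False
        by simp
    qed
  qed
  have "{i. i < n \<and> (i, i) \<in> {..<n} \<times> {..<n}} = {..<n}" by auto
  then have "t ({..<n} \<times> {..<n}) = (\<Sum>i<n. A $$ (i, i))"
    by (simp add: t_def)
  then have "A = R ({..<n} \<times> {..<n}) + unit_mat n 0 0 (\<Sum>i<n. A $$ (i, i))"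
    using A by (intro eq_matI) (auto simp: R_def)
  then show ?thesis
    using mat_commutator_subgroup_add[OF R_in unit_mat_commutator_span[OF assms(3,2)],
        of "{..<n} \<times> {..<n}"]
    by simp
qed

lemma scalar_mat_central:
  fixes c :: "'a::ring_1"
  assumes "c \<in> center"
  shows "mat n n (\<lambda>(i, j). if i = j then c else 0) \<in> ring_center (ring_mat TYPE('a) n ())"
proof -
  let ?C = "mat n n (\<lambda>(i, j). if i = j then c else 0)"
  have "?C * A = A * ?C" if A: "A \<in> carrier_mat n n" for A
  proof (rule eq_matI)
    fix r s assume "r < dim_row (A * ?C)" "s < dim_col (A * ?C)"
    then have rs: "r < n" "s < n" using A by auto
    have "(?C * A) $$ (r, s) = (\<Sum>t\<in>{0..<n}. (if r = t then c else 0) * A $$ (t, s))"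
      using rs A by (simp add: scalar_prod_def)
    also have "\<dots> = (\<Sum>t\<in>{0..<n}. if t = r then c * A $$ (r, s) else 0)"
      by (intro sum.cong) auto
    also have "\<dots> = A $$ (r, s) * c"
      using rs centralizerD[OF assms] by simp
    also have "\<dots> = (\<Sum>t\<in>{0..<n}. if t = s then A $$ (r, s) * c else 0)"
      using rs by simp
    also have "\<dots> = (\<Sum>t\<in>{0..<n}. A $$ (r, t) * (if t = s then c else 0))"
      by (intro sum.cong) auto
    also have "\<dots> = (A * ?C) $$ (r, s)"
      using rs A by (simp add: scalar_prod_def)
    finally show "(?C * A) $$ (r, s) = (A * ?C) $$ (r, s)" .
  qed (use A in auto)
  then show ?thesis by (simp add: ring_center_def ring_mat_simps)
qed

text \<open>To bring the trace \<open>d\<close> of a matrix into \<open>[D, D]\<close>, subtract the scalar matrix of a central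
  \<open>c\<close> with \<open>d / n - c \<in> [D, D]\<close>.\<close>

lemma mat_eq_center_plus_commutators:
  assumes "n > 0" "of_nat n \<noteq> (0::'a::division_ring)"
    and "\<And>x::'a. \<exists>z\<in>center. x - z \<in> commutator_span"
  shows "carrier (ring_mat TYPE('a) n ()) =
    ring_center (ring_mat TYPE('a) n ()) <+>\<^bsub>ring_mat TYPE('a) n ()\<^esub>
    commutator_subgroup (ring_mat TYPE('a) n ())"
proof (intro equalityI subsetI)
  fix A :: "'a mat" assume "A \<in> carrier (ring_mat TYPE('a) n ())"
  then have A: "A \<in> carrier_mat n n" by (simp add: ring_mat_simps)
  define d where "d = (\<Sum>i<n. A $$ (i, i))"
  obtain c where c: "c \<in> center" "inverse (of_nat n) * d - c \<in> commutator_span"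
    using assms(3) by blast
  have "of_nat n * (inverse (of_nat n) * d - c) = d - of_nat n * c"
    using assms(2) by (simp add: right_diff_distrib mult.assoc [symmetric])
  then have tr: "d - of_nat n * c \<in> commutator_span"
    using commutator_span_central_mult[OF centralizer_of_nat c(2)] by metis
  let ?C = "mat n n (\<lambda>(i, j). if i = j then c else 0)"
  have "(\<Sum>i<n. (A - ?C) $$ (i, i)) = d - of_nat n * c"
    using A by (simp add: d_def sum_subtractf)
  then have "A - ?C \<in> commutator_subgroup (ring_mat TYPE('a) n ())"
    using mat_trace_in_commutators[of "A - ?C" n] A tr assms(1) by (simp add: minus_carrier_mat)
  moreover have "A = ?C + (A - ?C)"
    using A by (auto intro!: eq_matI)
  ultimately show "A \<in> ring_center (ring_mat TYPE('a) n ()) <+>\<^bsub>ring_mat TYPE('a) n ()\<^esub>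
      commutator_subgroup (ring_mat TYPE('a) n ())"
    using scalar_mat_central[OF c(1), of n] by (auto simp: set_add_def' ring_mat_simps)
next
  fix A assume "A \<in> ring_center (ring_mat TYPE('a) n ()) <+>\<^bsub>ring_mat TYPE('a) n ()\<^esub>
      commutator_subgroup (ring_mat TYPE('a) n ())"
  then show "A \<in> carrier (ring_mat TYPE('a) n ())"
    using mat_commutator_subgroup_subset[of n, where 'a='a]
    by (auto simp: set_add_def' ring_center_def ring_mat_simps)
qed

section \<open>Decomposition of the matrix ring\<close>

theorem theorem2p1:
  fixes D :: "'a :: division_ring ring" and F :: "'a set" and n :: nat
  defines "D \<equiv> ring_of_type_algebra"
  defines "F \<equiv> ring_center D"
  assumes "n > 0"
    and "(algebraic_over_center D \<and> CHAR('a) = 0) \<or>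
         (\<exists>p. ring.finite_dimension D F (carrier D) \<and> CHAR('a) = p \<and> p > 0 \<and>
              \<not> p dvd sqrt_dim_over_center D \<and> \<not> p dvd n)"
  shows "carrier (ring_mat TYPE('a) n ()) =
           ring_center (ring_mat TYPE('a) n ()) <+>\<^bsub>ring_mat TYPE('a) n ()\<^esub>
           commutator_subgroup (ring_mat TYPE('a) n ())"
proof (rule mat_eq_center_plus_commutators[OF assms(3)])
  have F: "F = center" by (simp add: F_def D_def ring_center_type_algebra)
  have dim: "sqrt_dim_over_center D = floor_sqrt (D.dim center (UNIV :: 'a set))"
    by (simp add: sqrt_dim_over_center_def D_def ring_center_type_algebra)
  consider (algebraic) "algebraic_over_center (ring_of_type_algebra :: 'a ring)" "CHAR('a) = 0"
    | (finite_dim) "D.finite_dimension center (UNIV :: 'a set)" "\<not> CHAR('a) dvd n"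
        "\<not> CHAR('a) dvd floor_sqrt (D.dim center (UNIV :: 'a set))"
    using assms(4) unfolding F dim unfolding D_def type_algebra_simps
    by (elim disjE exE conjE) simp_all
  note cases = this
  show "of_nat n \<noteq> (0::'a)"
    using assms(3) by (cases rule: cases) (simp_all add: of_nat_eq_0_iff_char_dvd)
  fix x :: 'a
  have "\<exists>m f. minimal_relation x m f \<and> \<not> CHAR('a) dvd m"
  proof (cases rule: cases)
    case algebraic
    obtain m f where f: "minimal_relation x m f"
      by (rule algebraic_imp_minimal_relation[OF algebraic(1)])
    moreover have "\<not> CHAR('a) dvd m"
      using minimal_relation_degree_pos[OF f] algebraic(2) by simp
    ultimately show ?thesis by blast
  next
    case finite_dim
    obtain m f where "minimal_relation x m f"
      and "m dvd floor_sqrt (D.dim center (UNIV :: 'a set))"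
      by (rule degree_dvd_sqrt_dim[OF finite_dim(1)])
    then show ?thesis using finite_dim(3) dvd_trans[of "CHAR('a)" m] by blast
  qed
  then obtain m f where "minimal_relation x m f" "of_nat m \<noteq> (0::'a)"
    by (auto simp: of_nat_eq_0_iff_char_dvd)
  then show "\<exists>z\<in>center. x - z \<in> commutator_span"
    by (rule center_plus_commutators_of_degree)
qed

end
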